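(* Let $k$ be a field, let $G$ be a group with identity $e$ and let $F:G\times G\to k^*$ be any 2-cochain on $G$, i.e. $F(x,e)=F(e,x)=1$ for all $x\in G$. Let $k_FG$ be the vector space $kG$ with basis $G$ and with the modified product $$x\cdot_F y=F(x,y)\,xy,\qquad x,y\in G,$$ extended bilinearly, where the degree of $x\in G$ is $x$. Then $k_FG$ is a coboundary $G$-graded quasialgebra, with associated 3-cocycle $$\phi(x,y,z)=\frac{F(x,y)F(xy,z)}{F(y,z)F(x,yz)}.$$
   Context: A 3-cocycle on $G$ is a map $\phi:G\times G\times G\to k^*$ with $\phi(y,z,w)\phi(x,yz,w)\phi(x,y,z)=\phi(x,y,zw)\phi(xy,z,w)$ and $\phi(x,e,y)=1$ for all $x,y,z,w\in G$. A $G$-graded quasialgebra (with respect to a 3-cocycle $\phi$) is a $G$-graded vector space $A$ with a product $A\otimes A\to A$ preserving the total degree, with a unit of degree $e$, and such that $(a\cdot b)\cdot c=a\cdot(b\cdot c)\,\phi(|a|,|b|,|c|)$ for all homogeneous $a,b,c\in A$ of degrees $|a|,|b|,|c|$. It is called coboundary if $\phi$ has the form $\phi(x,y,z)=\frac{F(x,y)F(xy,z)}{F(y,z)F(x,yz)}$ for some $F:G\times G\to k^*$ with $F(x,e)=1=F(e,x)$ for all $x\in G$. *)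

theory Defs
  imports "HOL-Algebra.Module" "HOL-Library.FuncSet"
begin

text \<open>For a field \<open>k\<close> the multiplicative group \<open>k\<^sup>*\<close> is \<^term>\<open>Units k\<close>, and a quotient
  \<open>a / b\<close> is written \<open>a \<otimes>\<^bsub>k\<^esub> inv\<^bsub>k\<^esub> b\<close>. Cochains are curried functions whose
  values matter only on \<^term>\<open>carrier G\<close>.\<close>

definition two_cochain ::
  "('k, 'n) ring_scheme \<Rightarrow> ('g, 'm) monoid_scheme \<Rightarrow> ('g \<Rightarrow> 'g \<Rightarrow> 'k) \<Rightarrow> bool"
where
  "two_cochain k G F \<longleftrightarrow>
     (\<forall>x\<in>carrier G. \<forall>y\<in>carrier G. F x y \<in> Units k) \<and>
     (\<forall>x\<in>carrier G. F x \<one>\<^bsub>G\<^esub> = \<one>\<^bsub>k\<^esub> \<and> F \<one>\<^bsub>G\<^esub> x = \<one>\<^bsub>k\<^esub>)"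

definition three_cocycle ::
  "('k, 'n) ring_scheme \<Rightarrow> ('g, 'm) monoid_scheme \<Rightarrow> ('g \<Rightarrow> 'g \<Rightarrow> 'g \<Rightarrow> 'k) \<Rightarrow> bool"
where
  "three_cocycle k G \<phi> \<longleftrightarrow>
     (\<forall>x\<in>carrier G. \<forall>y\<in>carrier G. \<forall>z\<in>carrier G. \<phi> x y z \<in> Units k) \<and>
     (\<forall>x\<in>carrier G. \<forall>y\<in>carrier G. \<forall>z\<in>carrier G. \<forall>w\<in>carrier G.
        \<phi> y z w \<otimes>\<^bsub>k\<^esub> \<phi> x (y \<otimes>\<^bsub>G\<^esub> z) w \<otimes>\<^bsub>k\<^esub> \<phi> x y z =
        \<phi> x y (z \<otimes>\<^bsub>G\<^esub> w) \<otimes>\<^bsub>k\<^esub> \<phi> (x \<otimes>\<^bsub>G\<^esub> y) z w) \<and>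
     (\<forall>x\<in>carrier G. \<forall>y\<in>carrier G. \<phi> x \<one>\<^bsub>G\<^esub> y = \<one>\<^bsub>k\<^esub>)"

definition coboundary ::
  "('k, 'n) ring_scheme \<Rightarrow> ('g, 'm) monoid_scheme \<Rightarrow> ('g \<Rightarrow> 'g \<Rightarrow> 'k) \<Rightarrow> 'g \<Rightarrow> 'g \<Rightarrow> 'g \<Rightarrow> 'k"
where
  "coboundary k G F x y z =
     (F x y \<otimes>\<^bsub>k\<^esub> F (x \<otimes>\<^bsub>G\<^esub> y) z) \<otimes>\<^bsub>k\<^esub>
     inv\<^bsub>k\<^esub> (F y z \<otimes>\<^bsub>k\<^esub> F x (y \<otimes>\<^bsub>G\<^esub> z))"

text \<open>The vector space, product and unit of \<open>A\<close> are the fields of one \<^type>\<open>module\<close> record; the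
  locale \<^locale>\<open>module\<close> constrains only its additive and scalar structure. \<open>V x\<close> is the
  homogeneous component of degree \<open>x\<close>, and assumption \<open>decomposition\<close> says that \<open>A\<close> is the direct
  sum of the components. A linear map \<open>A \<otimes> A \<rightarrow> A\<close> is given as a bilinear product.\<close>

locale graded_quasialgebra =
  G: group G + K: field k + A: module k A
  for G :: "('g, 'm) monoid_scheme"
    and k :: "('k, 'n) ring_scheme"
    and A :: "('k, 'v, 'p) module_scheme" +
  fixes V :: "'g \<Rightarrow> 'v set"
    and \<phi> :: "'g \<Rightarrow> 'g \<Rightarrow> 'g \<Rightarrow> 'k"
  assumes cocycle: "three_cocycle k G \<phi>"
    and component: "x \<in> carrier G \<Longrightarrow> submodule (V x) k A"
    and decomposition: "a \<in> carrier A \<Longrightarrow>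
      \<exists>!c. c \<in> (\<Pi>\<^sub>E x\<in>carrier G. V x) \<and> finite {x \<in> carrier G. c x \<noteq> \<zero>\<^bsub>A\<^esub>} \<and>
        a = (\<Oplus>\<^bsub>A\<^esub>x\<in>{x \<in> carrier G. c x \<noteq> \<zero>\<^bsub>A\<^esub>}. c x)"
    and mult_closed: "\<lbrakk>a \<in> carrier A; b \<in> carrier A\<rbrakk> \<Longrightarrow> a \<otimes>\<^bsub>A\<^esub> b \<in> carrier A"
    and mult_add_left: "\<lbrakk>a \<in> carrier A; b \<in> carrier A; c \<in> carrier A\<rbrakk> \<Longrightarrow>
      (a \<oplus>\<^bsub>A\<^esub> b) \<otimes>\<^bsub>A\<^esub> c = a \<otimes>\<^bsub>A\<^esub> c \<oplus>\<^bsub>A\<^esub> b \<otimes>\<^bsub>A\<^esub> c"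
    and mult_add_right: "\<lbrakk>a \<in> carrier A; b \<in> carrier A; c \<in> carrier A\<rbrakk> \<Longrightarrow>
      a \<otimes>\<^bsub>A\<^esub> (b \<oplus>\<^bsub>A\<^esub> c) = a \<otimes>\<^bsub>A\<^esub> b \<oplus>\<^bsub>A\<^esub> a \<otimes>\<^bsub>A\<^esub> c"
    and mult_smult_left: "\<lbrakk>s \<in> carrier k; a \<in> carrier A; b \<in> carrier A\<rbrakk> \<Longrightarrow>
      (s \<odot>\<^bsub>A\<^esub> a) \<otimes>\<^bsub>A\<^esub> b = s \<odot>\<^bsub>A\<^esub> (a \<otimes>\<^bsub>A\<^esub> b)"
    and mult_smult_right: "\<lbrakk>s \<in> carrier k; a \<in> carrier A; b \<in> carrier A\<rbrakk> \<Longrightarrow>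
      a \<otimes>\<^bsub>A\<^esub> (s \<odot>\<^bsub>A\<^esub> b) = s \<odot>\<^bsub>A\<^esub> (a \<otimes>\<^bsub>A\<^esub> b)"
    and mult_degree: "\<lbrakk>x \<in> carrier G; y \<in> carrier G; a \<in> V x; b \<in> V y\<rbrakk> \<Longrightarrow>
      a \<otimes>\<^bsub>A\<^esub> b \<in> V (x \<otimes>\<^bsub>G\<^esub> y)"
    and unit_degree: "\<one>\<^bsub>A\<^esub> \<in> V \<one>\<^bsub>G\<^esub>"
    and unit_left: "a \<in> carrier A \<Longrightarrow> \<one>\<^bsub>A\<^esub> \<otimes>\<^bsub>A\<^esub> a = a"
    and unit_right: "a \<in> carrier A \<Longrightarrow> a \<otimes>\<^bsub>A\<^esub> \<one>\<^bsub>A\<^esub> = a"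
    and quasi_assoc: "\<lbrakk>x \<in> carrier G; y \<in> carrier G; z \<in> carrier G; a \<in> V x; b \<in> V y; c \<in> V z\<rbrakk> \<Longrightarrow>
      (a \<otimes>\<^bsub>A\<^esub> b) \<otimes>\<^bsub>A\<^esub> c = \<phi> x y z \<odot>\<^bsub>A\<^esub> (a \<otimes>\<^bsub>A\<^esub> (b \<otimes>\<^bsub>A\<^esub> c))"

definition coboundary_graded_quasialgebra ::
  "('g, 'm) monoid_scheme \<Rightarrow> ('k, 'n) ring_scheme \<Rightarrow> ('k, 'v, 'p) module_scheme \<Rightarrow>
   ('g \<Rightarrow> 'v set) \<Rightarrow> ('g \<Rightarrow> 'g \<Rightarrow> 'g \<Rightarrow> 'k) \<Rightarrow> bool"
where
  "coboundary_graded_quasialgebra G k A V \<phi> \<longleftrightarrow>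
     graded_quasialgebra G k A V \<phi> \<and>
     (\<exists>F. two_cochain k G F \<and>
        (\<forall>x\<in>carrier G. \<forall>y\<in>carrier G. \<forall>z\<in>carrier G. \<phi> x y z = coboundary k G F x y z))"

definition kG_support ::
  "('k, 'n) ring_scheme \<Rightarrow> ('g, 'm) monoid_scheme \<Rightarrow> ('g \<Rightarrow> 'k) \<Rightarrow> 'g set"
where
  "kG_support k G f = {x \<in> carrier G. f x \<noteq> \<zero>\<^bsub>k\<^esub>}"

definition kG_basis ::
  "('k, 'n) ring_scheme \<Rightarrow> ('g, 'm) monoid_scheme \<Rightarrow> 'g \<Rightarrow> 'g \<Rightarrow> 'k"
where
  "kG_basis k G x = (\<lambda>z\<in>carrier G. if z = x then \<one>\<^bsub>k\<^esub> else \<zero>\<^bsub>k\<^esub>)"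

text \<open>\<open>kG\<close> consists of the finitely supported functions \<open>G \<rightarrow> k\<close>, extensional so that equality
  only sees values on \<^term>\<open>carrier G\<close>. The product is the bilinear extension
  \<open>f \<cdot> g = \<Sum>\<^sub>x \<Sum>\<^sub>y f(x) g(y) F(x,y) xy\<close>, where the basis vector \<open>xy\<close> is
  \<^term>\<open>kG_basis k G (x \<otimes>\<^bsub>G\<^esub> y)\<close>, evaluated pointwise.\<close>

definition twisted_group_algebra ::
  "('k, 'n) ring_scheme \<Rightarrow> ('g, 'm) monoid_scheme \<Rightarrow> ('g \<Rightarrow> 'g \<Rightarrow> 'k) \<Rightarrow> ('k, 'g \<Rightarrow> 'k) module"
where
  "twisted_group_algebra k G F =
     \<lparr>carrier = {f \<in> carrier G \<rightarrow>\<^sub>E carrier k. finite (kG_support k G f)},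
      mult = (\<lambda>f g. \<lambda>z\<in>carrier G.
        \<Oplus>\<^bsub>k\<^esub>x\<in>kG_support k G f. \<Oplus>\<^bsub>k\<^esub>y\<in>kG_support k G g.
          (f x \<otimes>\<^bsub>k\<^esub> g y) \<otimes>\<^bsub>k\<^esub> (F x y \<otimes>\<^bsub>k\<^esub> kG_basis k G (x \<otimes>\<^bsub>G\<^esub> y) z)),
      one = kG_basis k G \<one>\<^bsub>G\<^esub>,
      zero = (\<lambda>z\<in>carrier G. \<zero>\<^bsub>k\<^esub>),
      add = (\<lambda>f g. \<lambda>z\<in>carrier G. f z \<oplus>\<^bsub>k\<^esub> g z),
      smult = (\<lambda>s f. \<lambda>z\<in>carrier G. s \<otimes>\<^bsub>k\<^esub> f z)\<rparr>"

text \<open>The degree-\<open>x\<close> component is the line spanned by the basis vector \<open>x\<close>.\<close>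

definition twisted_group_algebra_component ::
  "('k, 'n) ring_scheme \<Rightarrow> ('g, 'm) monoid_scheme \<Rightarrow> ('g \<Rightarrow> 'g \<Rightarrow> 'k) \<Rightarrow> 'g \<Rightarrow> ('g \<Rightarrow> 'k) set"
where
  "twisted_group_algebra_component k G F x =
     (\<lambda>s. s \<odot>\<^bsub>twisted_group_algebra k G F\<^esub> kG_basis k G x) ` carrier k"

lemma twisted_group_algebra_basis_mult:
  assumes "group G" "field k" "two_cochain k G F" "x \<in> carrier G" "y \<in> carrier G"
  shows "kG_basis k G x \<otimes>\<^bsub>twisted_group_algebra k G F\<^esub> kG_basis k G y =
         F x y \<odot>\<^bsub>twisted_group_algebra k G F\<^esub> kG_basis k G (x \<otimes>\<^bsub>G\<^esub> y)"
proof -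
  interpret G: group G by fact
  interpret K: field k by fact
  have F: "F x y \<in> carrier k"
    using assms by (auto simp: two_cochain_def)
  have supp: "kG_support k G (kG_basis k G u) = {u}" if "u \<in> carrier G" for u
    using that by (auto simp: kG_support_def kG_basis_def)
  have sum: "(\<Oplus>\<^bsub>k\<^esub>u\<in>{v}. h u) = h v" if "h v \<in> carrier k" for h and v :: 'a
    using that by (subst K.finsum_insert) auto
  have val: "kG_basis k G u z = (if z = u then \<one>\<^bsub>k\<^esub> else \<zero>\<^bsub>k\<^esub>)" if "z \<in> carrier G" for u z
    using that by (simp add: kG_basis_def)
  show ?thesis
    unfolding twisted_group_algebra_def
    using assms F by (auto simp: supp sum val fun_eq_iff restrict_def)
qed

end

theory Submission
  imports Defs
begin

text \<open>On basis vectors both bracketings of a threefold product are multiples of the same vector: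
  \<open>(x \<cdot> y) \<cdot> z = F(x,y) F(xy,z) xyz\<close> and \<open>x \<cdot> (y \<cdot> z) = F(y,z) F(x,yz) xyz\<close>. Their ratio is the
  coboundary of \<open>F\<close>, and since each homogeneous component is a line, bilinearity carries
  the relation to all homogeneous elements (\<open>component_quasi_assoc\<close>). The cocycle identity
  (\<open>coboundary_three_cocycle\<close>) is the statement that this ratio is consistent around the pentagon of
  bracketings of four factors; in a field it is a cancellation of values of \<open>F\<close>.

  What remains is to see that finitely supported functions on \<open>G\<close> really form a graded space with a
  bilinear unital product. The grading is the expansion \<open>a = \<Sum>\<^sub>x a(x) x\<close>, unique because the
  coefficient of \<open>z\<close> in a sum of homogeneous elements only sees the term of degree \<open>z\<close>
  (\<open>unique_decomposition\<close>). For the product, the double sum over pairs \<open>(x, y)\<close> is awkward since both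
  index sets depend on the factors. As \<open>G\<close> is a group, the pairs with \<open>xy = z\<close> are parametrised by
  \<open>x\<close>, so that
  \<open>(f \<cdot> g)(z) = \<Sum>\<^sub>x f(x) g(x\<inverse>z) F(x, x\<inverse>z)\<close>,
  where \<open>x\<close> may run over any finite set containing the support of \<open>f\<close> (\<open>mult_value\<close>). Closure,
  bilinearity and the unit laws are read off from this convolution formula.\<close>

locale twisted_group_ring =
  G: group G + K: field k
  for G :: "('g, 'm) monoid_scheme"
    and k :: "('k, 'n) ring_scheme" +
  fixes F :: "'g \<Rightarrow> 'g \<Rightarrow> 'k"
  assumes cochain: "two_cochain k G F"
begin

abbreviation A :: "('k, 'g \<Rightarrow> 'k) module"
  where "A \<equiv> twisted_group_algebra k G F"

abbreviation e :: "'g \<Rightarrow> 'g \<Rightarrow> 'k"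
  where "e \<equiv> kG_basis k G"

abbreviation V :: "'g \<Rightarrow> ('g \<Rightarrow> 'k) set"
  where "V \<equiv> twisted_group_algebra_component k G F"

abbreviation supp :: "('g \<Rightarrow> 'k) \<Rightarrow> 'g set"
  where "supp \<equiv> kG_support k G"

section \<open>Cochains and their coboundaries\<close>

lemma cochain_unit: "\<lbrakk>x \<in> carrier G; y \<in> carrier G\<rbrakk> \<Longrightarrow> F x y \<in> Units k"
  using cochain by (simp add: two_cochain_def)

lemma cochain_closed [simp]: "\<lbrakk>x \<in> carrier G; y \<in> carrier G\<rbrakk> \<Longrightarrow> F x y \<in> carrier k"
  using cochain_unit by blast

lemma cochain_one [simp]:
  assumes "x \<in> carrier G"
  shows "F x \<one>\<^bsub>G\<^esub> = \<one>\<^bsub>k\<^esub>" "F \<one>\<^bsub>G\<^esub> x = \<one>\<^bsub>k\<^esub>"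
  using cochain assms by (simp_all add: two_cochain_def)

lemma coboundary_unit:
  "\<lbrakk>x \<in> carrier G; y \<in> carrier G; z \<in> carrier G\<rbrakk> \<Longrightarrow> coboundary k G F x y z \<in> Units k"
  by (simp add: coboundary_def cochain_unit)

text \<open>Free of inverses, this form turns the cocycle identity and the associativity relation into
  identities between monomials in the values of \<open>F\<close>.\<close>

lemma coboundary_mult:
  assumes "x \<in> carrier G" "y \<in> carrier G" "z \<in> carrier G"
  shows "coboundary k G F x y z \<otimes>\<^bsub>k\<^esub> (F y z \<otimes>\<^bsub>k\<^esub> F x (y \<otimes>\<^bsub>G\<^esub> z)) =
         F x y \<otimes>\<^bsub>k\<^esub> F (x \<otimes>\<^bsub>G\<^esub> y) z"
  using assms by (simp add: coboundary_def cochain_unit K.m_assoc K.Units_l_inv)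

text \<open>The five coboundary values in the identity bring in ten values of \<open>F\<close>. Multiplied by \<open>?D\<close>,
  the product of the seven that occur in some denominator, both sides become the same monomial in
  the values of \<open>F\<close>; units can be cancelled.\<close>

lemma coboundary_three_cocycle: "three_cocycle k G (coboundary k G F)"
  unfolding three_cocycle_def
proof (intro conjI ballI)
  fix x y z w
  assume G: "x \<in> carrier G" "y \<in> carrier G" "z \<in> carrier G" "w \<in> carrier G"
  let ?p = "coboundary k G F"
  let ?yz = "y \<otimes>\<^bsub>G\<^esub> z" and ?xy = "x \<otimes>\<^bsub>G\<^esub> y" and ?zw = "z \<otimes>\<^bsub>G\<^esub> w"
  let ?p1 = "?p y z w" and ?p2 = "?p x ?yz w" and ?p3 = "?p x y z"
  let ?p4 = "?p x y ?zw" and ?p5 = "?p ?xy z w"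
  let ?a = "F y z" and ?b = "F ?yz w" and ?c = "F z w" and ?d = "F y ?zw" and ?q = "F x ?yz"
  let ?r = "F x (?yz \<otimes>\<^bsub>G\<^esub> w)" and ?s = "F (?xy \<otimes>\<^bsub>G\<^esub> z) w"
  let ?u = "F x y" and ?v = "F ?xy z" and ?t = "F ?xy ?zw"
  let ?D = "?a \<otimes>\<^bsub>k\<^esub> ?b \<otimes>\<^bsub>k\<^esub> ?q \<otimes>\<^bsub>k\<^esub> ?c \<otimes>\<^bsub>k\<^esub> ?d \<otimes>\<^bsub>k\<^esub> ?r \<otimes>\<^bsub>k\<^esub> ?t"
  have p: "?p1 \<in> carrier k" "?p2 \<in> carrier k" "?p3 \<in> carrier k" "?p4 \<in> carrier k" "?p5 \<in> carrier k"
    using coboundary_unit G by (simp_all add: K.Units_closed)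
  have F: "?a \<in> carrier k" "?b \<in> carrier k" "?c \<in> carrier k" "?d \<in> carrier k" "?q \<in> carrier k"
    "?r \<in> carrier k" "?s \<in> carrier k" "?u \<in> carrier k" "?v \<in> carrier k" "?t \<in> carrier k"
    using G by simp_all
  have D: "?D \<in> Units k"
    using G by (simp add: cochain_unit)
  have E: "?p1 \<otimes>\<^bsub>k\<^esub> (?c \<otimes>\<^bsub>k\<^esub> ?d) = ?a \<otimes>\<^bsub>k\<^esub> ?b"
    "?p2 \<otimes>\<^bsub>k\<^esub> (?b \<otimes>\<^bsub>k\<^esub> ?r) = ?q \<otimes>\<^bsub>k\<^esub> ?s"
    "?p3 \<otimes>\<^bsub>k\<^esub> (?a \<otimes>\<^bsub>k\<^esub> ?q) = ?u \<otimes>\<^bsub>k\<^esub> ?v"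
    "?p4 \<otimes>\<^bsub>k\<^esub> (?d \<otimes>\<^bsub>k\<^esub> ?r) = ?u \<otimes>\<^bsub>k\<^esub> ?t"
    "?p5 \<otimes>\<^bsub>k\<^esub> (?c \<otimes>\<^bsub>k\<^esub> ?t) = ?v \<otimes>\<^bsub>k\<^esub> ?s"
    using G coboundary_mult[of y z w] coboundary_mult[of x ?yz w] coboundary_mult[of x y z]
      coboundary_mult[of x y ?zw] coboundary_mult[of ?xy z w]
    by (simp_all add: G.m_assoc)
  have "?D \<otimes>\<^bsub>k\<^esub> (?p1 \<otimes>\<^bsub>k\<^esub> ?p2 \<otimes>\<^bsub>k\<^esub> ?p3) =
      (?p1 \<otimes>\<^bsub>k\<^esub> (?c \<otimes>\<^bsub>k\<^esub> ?d)) \<otimes>\<^bsub>k\<^esub> (?p2 \<otimes>\<^bsub>k\<^esub> (?b \<otimes>\<^bsub>k\<^esub> ?r)) \<otimes>\<^bsub>k\<^esub> (?p3 \<otimes>\<^bsub>k\<^esub> (?a \<otimes>\<^bsub>k\<^esub> ?q)) \<otimes>\<^bsub>k\<^esub> ?t"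
    using p F by (simp only: K.m_closed K.m_ac)
  also have "\<dots> = (?a \<otimes>\<^bsub>k\<^esub> ?b) \<otimes>\<^bsub>k\<^esub> (?q \<otimes>\<^bsub>k\<^esub> ?s) \<otimes>\<^bsub>k\<^esub> (?u \<otimes>\<^bsub>k\<^esub> ?v) \<otimes>\<^bsub>k\<^esub> ?t"
    by (simp only: E)
  also have "\<dots> = (?u \<otimes>\<^bsub>k\<^esub> ?t) \<otimes>\<^bsub>k\<^esub> (?v \<otimes>\<^bsub>k\<^esub> ?s) \<otimes>\<^bsub>k\<^esub> (?a \<otimes>\<^bsub>k\<^esub> ?b \<otimes>\<^bsub>k\<^esub> ?q)"
    using F by (simp only: K.m_closed K.m_ac)
  also have "\<dots> = (?p4 \<otimes>\<^bsub>k\<^esub> (?d \<otimes>\<^bsub>k\<^esub> ?r)) \<otimes>\<^bsub>k\<^esub> (?p5 \<otimes>\<^bsub>k\<^esub> (?c \<otimes>\<^bsub>k\<^esub> ?t)) \<otimes>\<^bsub>k\<^esub> (?a \<otimes>\<^bsub>k\<^esub> ?b \<otimes>\<^bsub>k\<^esub> ?q)"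
    by (simp only: E)
  also have "\<dots> = ?D \<otimes>\<^bsub>k\<^esub> (?p4 \<otimes>\<^bsub>k\<^esub> ?p5)"
    using p F by (simp only: K.m_closed K.m_ac)
  finally show "?p1 \<otimes>\<^bsub>k\<^esub> ?p2 \<otimes>\<^bsub>k\<^esub> ?p3 = ?p4 \<otimes>\<^bsub>k\<^esub> ?p5"
    using K.Units_l_cancel[OF D] p by simp
next
  fix x y assume G: "x \<in> carrier G" "y \<in> carrier G"
  then show "coboundary k G F x \<one>\<^bsub>G\<^esub> y = \<one>\<^bsub>k\<^esub>"
    by (simp add: coboundary_def cochain_unit K.Units_r_inv)
qed (rule coboundary_unit)

section \<open>The vector space and its grading\<close>

lemma supp_iff: "x \<in> supp f \<longleftrightarrow> x \<in> carrier G \<and> f x \<noteq> \<zero>\<^bsub>k\<^esub>"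
  by (simp add: kG_support_def)

lemma supp_carrier: "supp f \<subseteq> carrier G"
  by (auto simp: supp_iff)

lemma carrierI:
  assumes "f \<in> carrier G \<rightarrow>\<^sub>E carrier k" "finite S" "supp f \<subseteq> S"
  shows "f \<in> carrier A"
  using assms finite_subset by (auto simp: twisted_group_algebra_def)

lemma carrierD:
  assumes "f \<in> carrier A"
  shows value_closed: "x \<in> carrier G \<Longrightarrow> f x \<in> carrier k"
    and finite_supp: "finite (supp f)"
    and carrier_extensional: "f \<in> extensional (carrier G)"
  using assms by (auto simp: twisted_group_algebra_def PiE_def)

lemma eqI:
  assumes "f \<in> carrier A" "g \<in> carrier A" "\<And>z. z \<in> carrier G \<Longrightarrow> f z = g z"
  shows "f = g"
  using assms by (intro extensionalityI[of _ "carrier G"]) (auto dest: carrier_extensional)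

lemma value_simps [simp]:
  assumes "z \<in> carrier G"
  shows "\<zero>\<^bsub>A\<^esub> z = \<zero>\<^bsub>k\<^esub>" "(f \<oplus>\<^bsub>A\<^esub> g) z = f z \<oplus>\<^bsub>k\<^esub> g z" "(s \<odot>\<^bsub>A\<^esub> f) z = s \<otimes>\<^bsub>k\<^esub> f z"
    "e x z = (if z = x then \<one>\<^bsub>k\<^esub> else \<zero>\<^bsub>k\<^esub>)"
  using assms by (simp_all add: twisted_group_algebra_def kG_basis_def)

lemma zero_carrier: "\<zero>\<^bsub>A\<^esub> \<in> carrier A"
  by (rule carrierI[where S = "{}"]) (auto simp: supp_iff, auto simp: twisted_group_algebra_def)

lemma add_carrier:
  assumes "f \<in> carrier A" "g \<in> carrier A"
  shows "f \<oplus>\<^bsub>A\<^esub> g \<in> carrier A"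
proof (rule carrierI)
  show "f \<oplus>\<^bsub>A\<^esub> g \<in> carrier G \<rightarrow>\<^sub>E carrier k"
    using value_closed[OF assms(1)] value_closed[OF assms(2)]
    by (auto simp: twisted_group_algebra_def)
  show "finite (supp f \<union> supp g)"
    using assms finite_supp by blast
  show "supp (f \<oplus>\<^bsub>A\<^esub> g) \<subseteq> supp f \<union> supp g"
    by (auto simp: supp_iff)
qed

lemma smult_carrier:
  assumes "s \<in> carrier k" "f \<in> carrier A"
  shows "s \<odot>\<^bsub>A\<^esub> f \<in> carrier A"
proof (rule carrierI)
  show "s \<odot>\<^bsub>A\<^esub> f \<in> carrier G \<rightarrow>\<^sub>E carrier k"
    using assms(1) value_closed[OF assms(2)] by (auto simp: twisted_group_algebra_def)
  show "finite (supp f)"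
    using assms finite_supp by blast
  show "supp (s \<odot>\<^bsub>A\<^esub> f) \<subseteq> supp f"
    using assms by (auto simp: supp_iff)
qed

lemma basis_carrier [simp]: "e x \<in> carrier A"
  by (rule carrierI[where S = "{x}"])
    (auto simp: supp_iff split: if_splits, auto simp: kG_basis_def)

sublocale A: module k A
proof (rule moduleI)
  show "abelian_group A"
  proof (rule abelian_groupI)
    fix f assume f: "f \<in> carrier A"
    show "\<exists>g\<in>carrier A. g \<oplus>\<^bsub>A\<^esub> f = \<zero>\<^bsub>A\<^esub>"
      using f value_closed[OF f]
      by (intro bexI[of _ "(\<ominus>\<^bsub>k\<^esub> \<one>\<^bsub>k\<^esub>) \<odot>\<^bsub>A\<^esub> f"])
        (auto intro!: eqI smult_carrier add_carrier zero_carrier simp: K.l_minus K.l_neg)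
  qed (auto intro!: eqI add_carrier zero_carrier
        simp: value_closed K.a_ac)
qed (auto intro!: eqI add_carrier smult_carrier K.cring_axioms
      simp: value_closed K.l_distr K.r_distr K.m_assoc)

lemma component_iff: "a \<in> V x \<longleftrightarrow> (\<exists>s\<in>carrier k. a = s \<odot>\<^bsub>A\<^esub> e x)"
  by (auto simp: twisted_group_algebra_component_def)

lemma smult_basis_component: "s \<in> carrier k \<Longrightarrow> s \<odot>\<^bsub>A\<^esub> e x \<in> V x"
  by (auto simp: component_iff)

lemma component_carrier: "a \<in> V x \<Longrightarrow> a \<in> carrier A"
  by (auto simp: component_iff)

lemma component_submodule: "submodule (V x) k A"
proof (rule A.submoduleI)
  show "V x \<subseteq> carrier A"
    using component_carrier by blast
  show "\<zero>\<^bsub>A\<^esub> \<in> V x"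
    unfolding component_iff by (metis A.smult_l_null K.zero_closed basis_carrier)
  show "\<ominus>\<^bsub>A\<^esub> a \<in> V x" if "a \<in> V x" for a
    using that unfolding component_iff by (metis A.smult_l_minus K.a_inv_closed basis_carrier)
  show "a \<oplus>\<^bsub>A\<^esub> b \<in> V x" if "a \<in> V x" "b \<in> V x" for a b
    using that unfolding component_iff by (metis A.smult_l_distr K.a_closed basis_carrier)
  show "s \<odot>\<^bsub>A\<^esub> a \<in> V x" if "s \<in> carrier k" "a \<in> V x" for s a
    using that unfolding component_iff by (metis A.smult_assoc1 K.m_closed basis_carrier)
qed

lemma component_value_zero:
  assumes "a \<in> V x" "z \<in> carrier G" "z \<noteq> x"
  shows "a z = \<zero>\<^bsub>k\<^esub>"
  using assms by (auto simp: component_iff)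

lemma component_eq_smult_basis:
  assumes "a \<in> V x" "x \<in> carrier G"
  shows "a = a x \<odot>\<^bsub>A\<^esub> e x"
  using assms by (auto simp: component_iff)

lemma finsum_value:
  assumes "z \<in> carrier G" "c \<in> S \<rightarrow> carrier A"
  shows "(\<Oplus>\<^bsub>A\<^esub>x\<in>S. c x) z = (\<Oplus>\<^bsub>k\<^esub>x\<in>S. c x z)"
  using assms(2)
proof (induction S rule: infinite_finite_induct)
  case (insert x S)
  have "(\<lambda>x. c x z) \<in> S \<rightarrow> carrier k" "c x z \<in> carrier k"
    using insert.prems assms(1) value_closed by blast+
  with insert assms(1) show ?case
    by (subst A.finsum_insert) (auto simp: Pi_iff)
qed (use assms(1) in auto)

text \<open>Only the summand of degree \<open>z\<close> has a coefficient at \<open>z\<close>. If \<open>z\<close> is missing from the index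
  set, then \<open>c z\<close> is the zero vector and the formula still holds.\<close>

lemma finsum_components_value:
  assumes c: "c \<in> (\<Pi>\<^sub>E x\<in>carrier G. V x)"
    and fin: "finite {x \<in> carrier G. c x \<noteq> \<zero>\<^bsub>A\<^esub>}"
    and z: "z \<in> carrier G"
  shows "(\<Oplus>\<^bsub>A\<^esub>x\<in>{x \<in> carrier G. c x \<noteq> \<zero>\<^bsub>A\<^esub>}. c x) z = c z z"
proof -
  let ?S = "{x \<in> carrier G. c x \<noteq> \<zero>\<^bsub>A\<^esub>}"
  have V: "c x \<in> V x" if "x \<in> carrier G" for x
    using c that by (auto simp: PiE_iff)
  then have cA: "c x \<in> carrier A" if "x \<in> carrier G" for x
    using that component_carrier by blast
  have "(\<Oplus>\<^bsub>A\<^esub>x\<in>?S. c x) z = (\<Oplus>\<^bsub>k\<^esub>x\<in>?S. c x z)"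
    using cA z by (intro finsum_value) auto
  also have "\<dots> = (\<Oplus>\<^bsub>k\<^esub>x\<in>{z}. c x z)"
    using fin z cA component_value_zero[OF V]
    by (intro K.add.finprod_mono_neutral_cong) (auto simp: value_closed)
  also have "\<dots> = c z z"
    using cA z by (simp add: value_closed)
  finally show ?thesis .
qed

text \<open>The components of \<open>a\<close> must be \<open>a(x) x\<close>: a homogeneous vector of degree \<open>x\<close> is determined by
  its value at \<open>x\<close>, and evaluating the sum at \<open>x\<close> shows that this value is \<open>a(x)\<close>.\<close>

lemma unique_decomposition:
  assumes a: "a \<in> carrier A"
  shows "\<exists>!c. c \<in> (\<Pi>\<^sub>E x\<in>carrier G. V x) \<and> finite {x \<in> carrier G. c x \<noteq> \<zero>\<^bsub>A\<^esub>} \<and>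
           a = (\<Oplus>\<^bsub>A\<^esub>x\<in>{x \<in> carrier G. c x \<noteq> \<zero>\<^bsub>A\<^esub>}. c x)"
proof (rule ex1I)
  let ?c = "\<lambda>x\<in>carrier G. a x \<odot>\<^bsub>A\<^esub> e x"
  have c: "?c \<in> (\<Pi>\<^sub>E x\<in>carrier G. V x)"
    using smult_basis_component value_closed[OF a] by auto
  have "{x \<in> carrier G. ?c x \<noteq> \<zero>\<^bsub>A\<^esub>} \<subseteq> supp a"
    by (auto simp: supp_iff)
  then have fin: "finite {x \<in> carrier G. ?c x \<noteq> \<zero>\<^bsub>A\<^esub>}"
    using finite_supp[OF a] finite_subset by blast
  have "a = (\<Oplus>\<^bsub>A\<^esub>x\<in>{x \<in> carrier G. ?c x \<noteq> \<zero>\<^bsub>A\<^esub>}. ?c x)"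
  proof (rule eqI[OF a])
    show "(\<Oplus>\<^bsub>A\<^esub>x\<in>{x \<in> carrier G. ?c x \<noteq> \<zero>\<^bsub>A\<^esub>}. ?c x) \<in> carrier A"
      using value_closed[OF a] by (intro A.finsum_closed) auto
    show "a z = (\<Oplus>\<^bsub>A\<^esub>x\<in>{x \<in> carrier G. ?c x \<noteq> \<zero>\<^bsub>A\<^esub>}. ?c x) z" if "z \<in> carrier G" for z
      unfolding finsum_components_value[OF c fin that] using that value_closed[OF a] by simp
  qed
  with c fin show "?c \<in> (\<Pi>\<^sub>E x\<in>carrier G. V x) \<and> finite {x \<in> carrier G. ?c x \<noteq> \<zero>\<^bsub>A\<^esub>} \<and>
      a = (\<Oplus>\<^bsub>A\<^esub>x\<in>{x \<in> carrier G. ?c x \<noteq> \<zero>\<^bsub>A\<^esub>}. ?c x)"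
    by blast
  fix d
  assume d: "d \<in> (\<Pi>\<^sub>E x\<in>carrier G. V x) \<and> finite {x \<in> carrier G. d x \<noteq> \<zero>\<^bsub>A\<^esub>} \<and>
      a = (\<Oplus>\<^bsub>A\<^esub>x\<in>{x \<in> carrier G. d x \<noteq> \<zero>\<^bsub>A\<^esub>}. d x)"
  show "d = ?c"
  proof (rule extensionalityI[of _ "carrier G"])
    fix x assume x: "x \<in> carrier G"
    have "d x x = a x"
      using finsum_components_value[of d x] d x by metis
    moreover have "d x = d x x \<odot>\<^bsub>A\<^esub> e x"
      using component_eq_smult_basis d x by blast
    ultimately show "d x = ?c x"
      using x by simp
  qed (use d in \<open>auto simp: PiE_iff\<close>)
qed

section \<open>The product as a convolution\<close>

text \<open>The contribution of \<open>x\<close> to the coefficient of \<open>z\<close> in a product: the second factor of a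
  factorisation \<open>z = x y\<close> has to be \<open>x\<inverse>z\<close>.\<close>

definition summand :: "('g \<Rightarrow> 'k) \<Rightarrow> ('g \<Rightarrow> 'k) \<Rightarrow> 'g \<Rightarrow> 'g \<Rightarrow> 'k"
  where "summand f g z x = f x \<otimes>\<^bsub>k\<^esub> g (inv\<^bsub>G\<^esub> x \<otimes>\<^bsub>G\<^esub> z) \<otimes>\<^bsub>k\<^esub> F x (inv\<^bsub>G\<^esub> x \<otimes>\<^bsub>G\<^esub> z)"

lemma summand_closed:
  assumes "f \<in> carrier A" "g \<in> carrier A" "x \<in> carrier G" "z \<in> carrier G"
  shows "summand f g z x \<in> carrier k"
  using assms by (simp add: summand_def value_closed)

lemma summand_funcset:
  assumes "f \<in> carrier A" "g \<in> carrier A" "S \<subseteq> carrier G" "z \<in> carrier G"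
  shows "summand f g z \<in> S \<rightarrow> carrier k"
  using assms summand_closed by blast

lemma summand_zero:
  assumes "g \<in> carrier A" "x \<in> carrier G" "z \<in> carrier G" "f x = \<zero>\<^bsub>k\<^esub>"
  shows "summand f g z x = \<zero>\<^bsub>k\<^esub>"
  using assms by (simp add: summand_def value_closed)

lemma mult_left_inverse:
  "\<lbrakk>x \<in> carrier G; z \<in> carrier G\<rbrakk> \<Longrightarrow> x \<otimes>\<^bsub>G\<^esub> (inv\<^bsub>G\<^esub> x \<otimes>\<^bsub>G\<^esub> z) = z"
  by (simp add: G.m_assoc[symmetric])

text \<open>In the inner sum of the product the factor \<open>e (x y) z\<close> vanishes unless \<open>y = x\<inverse>z\<close>. That one
  index may lie outside the support of \<open>g\<close>, but then \<open>g\<close> makes its term zero.\<close>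

lemma sum_over_support:
  assumes f: "f \<in> carrier A" and g: "g \<in> carrier A"
    and x: "x \<in> carrier G" and z: "z \<in> carrier G"
  shows "(\<Oplus>\<^bsub>k\<^esub>y\<in>supp g. (f x \<otimes>\<^bsub>k\<^esub> g y) \<otimes>\<^bsub>k\<^esub> (F x y \<otimes>\<^bsub>k\<^esub> e (x \<otimes>\<^bsub>G\<^esub> y) z)) = summand f g z x"
    (is "(\<Oplus>\<^bsub>k\<^esub>y\<in>supp g. ?t y) = _")
proof -
  let ?y = "inv\<^bsub>G\<^esub> x \<otimes>\<^bsub>G\<^esub> z"
  note fx = value_closed[OF f x] and gy = value_closed[OF g]
  have y: "?y \<in> carrier G" "x \<otimes>\<^bsub>G\<^esub> ?y = z"
    using x z by (simp_all add: mult_left_inverse)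
  have t: "?t v \<in> carrier k" if "v \<in> carrier G" for v
    using that x z fx gy by simp
  have "(\<Oplus>\<^bsub>k\<^esub>y\<in>supp g. ?t y) = (\<Oplus>\<^bsub>k\<^esub>y\<in>{?y}. ?t y)"
  proof (rule K.add.finprod_mono_neutral_cong)
    show "?t v = \<zero>\<^bsub>k\<^esub>" if "v \<in> supp g - {?y}" for v
    proof -
      have v: "v \<in> carrier G" "v \<noteq> ?y"
        using that by (auto simp: supp_iff)
      then have "z \<noteq> x \<otimes>\<^bsub>G\<^esub> v"
        using x y by (metis G.m_assoc G.inv_closed G.l_inv G.l_one)
      then show ?thesis
        using v(1) x z fx gy by simp
    qed
    show "?t v = \<zero>\<^bsub>k\<^esub>" if "v \<in> {?y} - supp g" for v
    proof -
      have "v \<in> carrier G" "g v = \<zero>\<^bsub>k\<^esub>"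
        using that y(1) by (auto simp: supp_iff)
      then show ?thesis
        using x z fx by simp
    qed
    show "?t \<in> supp g \<rightarrow> carrier k" "?t \<in> {?y} \<rightarrow> carrier k"
      using t y(1) supp_carrier by blast+
  qed (use finite_supp[OF g] in auto)
  also have "\<dots> = ?t ?y"
    using t[OF y(1)] by simp
  also have "\<dots> = summand f g z x"
    using x y z fx gy by (simp add: summand_def)
  finally show ?thesis .
qed

text \<open>Terms outside the support of \<open>f\<close> are zero, so the index set may be enlarged. The freedom to
  choose \<open>S\<close> lets sums for different left factors be compared over a common index set.\<close>

lemma mult_value:
  assumes f: "f \<in> carrier A" and g: "g \<in> carrier A"
    and S: "finite S" "supp f \<subseteq> S" "S \<subseteq> carrier G"
    and z: "z \<in> carrier G"
  shows "(f \<otimes>\<^bsub>A\<^esub> g) z = (\<Oplus>\<^bsub>k\<^esub>x\<in>S. summand f g z x)"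
proof -
  let ?t = "\<lambda>x. \<Oplus>\<^bsub>k\<^esub>y\<in>supp g. (f x \<otimes>\<^bsub>k\<^esub> g y) \<otimes>\<^bsub>k\<^esub> (F x y \<otimes>\<^bsub>k\<^esub> e (x \<otimes>\<^bsub>G\<^esub> y) z)"
  have "(f \<otimes>\<^bsub>A\<^esub> g) z = (\<Oplus>\<^bsub>k\<^esub>x\<in>supp f. ?t x)"
    using z by (simp add: twisted_group_algebra_def)
  also have "\<dots> = (\<Oplus>\<^bsub>k\<^esub>x\<in>S. summand f g z x)"
  proof (rule K.add.finprod_mono_neutral_cong_left)
    show "summand f g z x = \<zero>\<^bsub>k\<^esub>" if "x \<in> S - supp f" for x
      using that S(3) by (intro summand_zero[OF g _ z]) (auto simp: supp_iff)
    show "?t x = summand f g z x" if "x \<in> supp f" for x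
      using that sum_over_support[OF f g _ z] supp_carrier by blast
    show "summand f g z \<in> S \<rightarrow> carrier k"
      by (rule summand_funcset[OF f g S(3) z])
  qed (use S in auto)
  finally show ?thesis .
qed

text \<open>A product has finite support because \<open>z\<close> can only lie in it if \<open>z = x y\<close> with \<open>x\<close>, \<open>y\<close> in the
  supports of the factors.\<close>

lemma mult_carrier:
  assumes f: "f \<in> carrier A" and g: "g \<in> carrier A"
  shows "f \<otimes>\<^bsub>A\<^esub> g \<in> carrier A"
proof (rule carrierI)
  note val = mult_value[OF f g finite_supp[OF f] order_refl supp_carrier]
  have "f \<otimes>\<^bsub>A\<^esub> g \<in> extensional (carrier G)"
    by (simp add: twisted_group_algebra_def)
  moreover have "(f \<otimes>\<^bsub>A\<^esub> g) z \<in> carrier k" if "z \<in> carrier G" for z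
    unfolding val[OF that]
    by (intro K.finsum_closed summand_funcset[OF f g supp_carrier that])
  ultimately show "f \<otimes>\<^bsub>A\<^esub> g \<in> carrier G \<rightarrow>\<^sub>E carrier k"
    by (auto simp: PiE_iff)
  show "finite ((\<lambda>(x, y). x \<otimes>\<^bsub>G\<^esub> y) ` (supp f \<times> supp g))"
    using finite_supp f g by blast
  show "supp (f \<otimes>\<^bsub>A\<^esub> g) \<subseteq> (\<lambda>(x, y). x \<otimes>\<^bsub>G\<^esub> y) ` (supp f \<times> supp g)"
  proof
    fix z assume "z \<in> supp (f \<otimes>\<^bsub>A\<^esub> g)"
    then have z: "z \<in> carrier G" and nz: "(f \<otimes>\<^bsub>A\<^esub> g) z \<noteq> \<zero>\<^bsub>k\<^esub>"
      by (auto simp: supp_iff)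
    have "\<exists>x\<in>supp f. summand f g z x \<noteq> \<zero>\<^bsub>k\<^esub>"
    proof (rule ccontr)
      assume "\<not> ?thesis"
      then have "(\<Oplus>\<^bsub>k\<^esub>x\<in>supp f. summand f g z x) = \<zero>\<^bsub>k\<^esub>"
        by (intro K.add.finprod_one_eqI) blast
      with nz val[OF z] show False
        by simp
    qed
    then obtain x where x: "x \<in> supp f" "summand f g z x \<noteq> \<zero>\<^bsub>k\<^esub>"
      by blast
    then have xG: "x \<in> carrier G"
      by (simp add: supp_iff)
    have "g (inv\<^bsub>G\<^esub> x \<otimes>\<^bsub>G\<^esub> z) \<noteq> \<zero>\<^bsub>k\<^esub>"
      using x(2) xG z value_closed[OF f xG] by (auto simp: summand_def)
    then have "inv\<^bsub>G\<^esub> x \<otimes>\<^bsub>G\<^esub> z \<in> supp g"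
      using xG z by (simp add: supp_iff)
    then show "z \<in> (\<lambda>(x, y). x \<otimes>\<^bsub>G\<^esub> y) ` (supp f \<times> supp g)"
      using x(1) xG z by (intro image_eqI[of _ _ "(x, inv\<^bsub>G\<^esub> x \<otimes>\<^bsub>G\<^esub> z)"])
        (simp_all add: mult_left_inverse)
  qed
qed

lemma mult_add_left:
  assumes f: "f \<in> carrier A" and f': "f' \<in> carrier A" and g: "g \<in> carrier A"
  shows "(f \<oplus>\<^bsub>A\<^esub> f') \<otimes>\<^bsub>A\<^esub> g = f \<otimes>\<^bsub>A\<^esub> g \<oplus>\<^bsub>A\<^esub> f' \<otimes>\<^bsub>A\<^esub> g"
proof (rule eqI)
  fix z assume z: "z \<in> carrier G"
  let ?S = "supp f \<union> supp f'"
  have S: "finite ?S" "?S \<subseteq> carrier G" "supp f \<subseteq> ?S" "supp f' \<subseteq> ?S" "supp (f \<oplus>\<^bsub>A\<^esub> f') \<subseteq> ?S"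
    using finite_supp f f' by (auto simp: supp_iff)
  have add: "summand (f \<oplus>\<^bsub>A\<^esub> f') g z x = summand f g z x \<oplus>\<^bsub>k\<^esub> summand f' g z x" if "x \<in> ?S" for x
  proof -
    have "x \<in> carrier G"
      using that S(2) by blast
    then show ?thesis
      using z f f' g by (simp add: summand_def value_closed K.l_distr)
  qed
  have closed: "summand f g z \<in> ?S \<rightarrow> carrier k" "summand f' g z \<in> ?S \<rightarrow> carrier k"
    using summand_funcset[OF _ g S(2) z] f f' by auto
  have "((f \<oplus>\<^bsub>A\<^esub> f') \<otimes>\<^bsub>A\<^esub> g) z = (\<Oplus>\<^bsub>k\<^esub>x\<in>?S. summand (f \<oplus>\<^bsub>A\<^esub> f') g z x)"
    by (rule mult_value[OF add_carrier[OF f f'] g S(1,5,2) z])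
  also have "\<dots> = (\<Oplus>\<^bsub>k\<^esub>x\<in>?S. summand f g z x \<oplus>\<^bsub>k\<^esub> summand f' g z x)"
    by (rule K.finsum_cong') (use add closed in \<open>auto simp: Pi_iff\<close>)
  also have "\<dots> = (\<Oplus>\<^bsub>k\<^esub>x\<in>?S. summand f g z x) \<oplus>\<^bsub>k\<^esub> (\<Oplus>\<^bsub>k\<^esub>x\<in>?S. summand f' g z x)"
    by (rule K.finsum_addf[OF closed])
  also have "\<dots> = (f \<otimes>\<^bsub>A\<^esub> g \<oplus>\<^bsub>A\<^esub> f' \<otimes>\<^bsub>A\<^esub> g) z"
    using z by (simp only: value_simps mult_value[OF f g S(1,3,2) z] mult_value[OF f' g S(1,4,2) z])
  finally show "((f \<oplus>\<^bsub>A\<^esub> f') \<otimes>\<^bsub>A\<^esub> g) z = (f \<otimes>\<^bsub>A\<^esub> g \<oplus>\<^bsub>A\<^esub> f' \<otimes>\<^bsub>A\<^esub> g) z" .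
qed (use assms mult_carrier in auto)

lemma mult_add_right:
  assumes f: "f \<in> carrier A" and g: "g \<in> carrier A" and g': "g' \<in> carrier A"
  shows "f \<otimes>\<^bsub>A\<^esub> (g \<oplus>\<^bsub>A\<^esub> g') = f \<otimes>\<^bsub>A\<^esub> g \<oplus>\<^bsub>A\<^esub> f \<otimes>\<^bsub>A\<^esub> g'"
proof (rule eqI)
  fix z assume z: "z \<in> carrier G"
  note val = mult_value[OF f _ finite_supp[OF f] order_refl supp_carrier z]
  have add: "summand f (g \<oplus>\<^bsub>A\<^esub> g') z x = summand f g z x \<oplus>\<^bsub>k\<^esub> summand f g' z x" if "x \<in> supp f" for x
  proof -
    have "x \<in> carrier G"
      using that supp_carrier by blast
    then show ?thesis
      using z f g g' by (simp add: summand_def value_closed K.l_distr K.r_distr)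
  qed
  have closed: "summand f g z \<in> supp f \<rightarrow> carrier k" "summand f g' z \<in> supp f \<rightarrow> carrier k"
    using summand_funcset[OF f _ supp_carrier z] g g' by auto
  have "(f \<otimes>\<^bsub>A\<^esub> (g \<oplus>\<^bsub>A\<^esub> g')) z = (\<Oplus>\<^bsub>k\<^esub>x\<in>supp f. summand f (g \<oplus>\<^bsub>A\<^esub> g') z x)"
    by (rule val[OF add_carrier[OF g g']])
  also have "\<dots> = (\<Oplus>\<^bsub>k\<^esub>x\<in>supp f. summand f g z x \<oplus>\<^bsub>k\<^esub> summand f g' z x)"
    by (rule K.finsum_cong') (use add closed in \<open>auto simp: Pi_iff\<close>)
  also have "\<dots> = (\<Oplus>\<^bsub>k\<^esub>x\<in>supp f. summand f g z x) \<oplus>\<^bsub>k\<^esub> (\<Oplus>\<^bsub>k\<^esub>x\<in>supp f. summand f g' z x)"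
    by (rule K.finsum_addf[OF closed])
  also have "\<dots> = (f \<otimes>\<^bsub>A\<^esub> g \<oplus>\<^bsub>A\<^esub> f \<otimes>\<^bsub>A\<^esub> g') z"
    using z by (simp only: value_simps val[OF g] val[OF g'])
  finally show "(f \<otimes>\<^bsub>A\<^esub> (g \<oplus>\<^bsub>A\<^esub> g')) z = (f \<otimes>\<^bsub>A\<^esub> g \<oplus>\<^bsub>A\<^esub> f \<otimes>\<^bsub>A\<^esub> g') z" .
qed (use assms mult_carrier in auto)

lemma mult_smult_left:
  assumes s: "s \<in> carrier k" and f: "f \<in> carrier A" and g: "g \<in> carrier A"
  shows "(s \<odot>\<^bsub>A\<^esub> f) \<otimes>\<^bsub>A\<^esub> g = s \<odot>\<^bsub>A\<^esub> (f \<otimes>\<^bsub>A\<^esub> g)"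
proof (rule eqI)
  fix z assume z: "z \<in> carrier G"
  have supp: "supp (s \<odot>\<^bsub>A\<^esub> f) \<subseteq> supp f"
    using s by (auto simp: supp_iff)
  have scale: "summand (s \<odot>\<^bsub>A\<^esub> f) g z x = s \<otimes>\<^bsub>k\<^esub> summand f g z x" if "x \<in> supp f" for x
  proof -
    have "x \<in> carrier G"
      using that supp_carrier by blast
    then show ?thesis
      using z s f g by (simp add: summand_def value_closed K.m_assoc)
  qed
  have closed: "summand f g z \<in> supp f \<rightarrow> carrier k"
    by (rule summand_funcset[OF f g supp_carrier z])
  have "((s \<odot>\<^bsub>A\<^esub> f) \<otimes>\<^bsub>A\<^esub> g) z = (\<Oplus>\<^bsub>k\<^esub>x\<in>supp f. summand (s \<odot>\<^bsub>A\<^esub> f) g z x)"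
    by (rule mult_value[OF smult_carrier[OF s f] g finite_supp[OF f] supp supp_carrier z])
  also have "\<dots> = (\<Oplus>\<^bsub>k\<^esub>x\<in>supp f. s \<otimes>\<^bsub>k\<^esub> summand f g z x)"
    by (rule K.finsum_cong') (use scale closed s in \<open>auto simp: Pi_iff\<close>)
  also have "\<dots> = s \<otimes>\<^bsub>k\<^esub> (\<Oplus>\<^bsub>k\<^esub>x\<in>supp f. summand f g z x)"
    using K.finsum_rdistr[OF finite_supp[OF f] s closed] by simp
  also have "\<dots> = (s \<odot>\<^bsub>A\<^esub> (f \<otimes>\<^bsub>A\<^esub> g)) z"
    using z by (simp only: value_simps mult_value[OF f g finite_supp[OF f] order_refl supp_carrier z])
  finally show "((s \<odot>\<^bsub>A\<^esub> f) \<otimes>\<^bsub>A\<^esub> g) z = (s \<odot>\<^bsub>A\<^esub> (f \<otimes>\<^bsub>A\<^esub> g)) z" .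
qed (use assms mult_carrier in auto)

lemma mult_smult_right:
  assumes s: "s \<in> carrier k" and f: "f \<in> carrier A" and g: "g \<in> carrier A"
  shows "f \<otimes>\<^bsub>A\<^esub> (s \<odot>\<^bsub>A\<^esub> g) = s \<odot>\<^bsub>A\<^esub> (f \<otimes>\<^bsub>A\<^esub> g)"
proof (rule eqI)
  fix z assume z: "z \<in> carrier G"
  note val = mult_value[OF f _ finite_supp[OF f] order_refl supp_carrier z]
  have scale: "summand f (s \<odot>\<^bsub>A\<^esub> g) z x = s \<otimes>\<^bsub>k\<^esub> summand f g z x" if "x \<in> supp f" for x
  proof -
    have "x \<in> carrier G"
      using that supp_carrier by blast
    then show ?thesis
      using z s f g by (simp add: summand_def value_closed K.m_ac)
  qed
  have closed: "summand f g z \<in> supp f \<rightarrow> carrier k"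
    by (rule summand_funcset[OF f g supp_carrier z])
  have "(f \<otimes>\<^bsub>A\<^esub> (s \<odot>\<^bsub>A\<^esub> g)) z = (\<Oplus>\<^bsub>k\<^esub>x\<in>supp f. summand f (s \<odot>\<^bsub>A\<^esub> g) z x)"
    by (rule val[OF smult_carrier[OF s g]])
  also have "\<dots> = (\<Oplus>\<^bsub>k\<^esub>x\<in>supp f. s \<otimes>\<^bsub>k\<^esub> summand f g z x)"
    by (rule K.finsum_cong') (use scale closed s in \<open>auto simp: Pi_iff\<close>)
  also have "\<dots> = s \<otimes>\<^bsub>k\<^esub> (\<Oplus>\<^bsub>k\<^esub>x\<in>supp f. summand f g z x)"
    using K.finsum_rdistr[OF finite_supp[OF f] s closed] by simp
  also have "\<dots> = (s \<odot>\<^bsub>A\<^esub> (f \<otimes>\<^bsub>A\<^esub> g)) z"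
    using z by (simp only: value_simps val[OF g])
  finally show "(f \<otimes>\<^bsub>A\<^esub> (s \<odot>\<^bsub>A\<^esub> g)) z = (s \<odot>\<^bsub>A\<^esub> (f \<otimes>\<^bsub>A\<^esub> g)) z" .
qed (use assms mult_carrier in auto)

lemma one_eq_basis: "\<one>\<^bsub>A\<^esub> = e \<one>\<^bsub>G\<^esub>"
  by (simp add: twisted_group_algebra_def)

lemma one_mult:
  assumes f: "f \<in> carrier A"
  shows "\<one>\<^bsub>A\<^esub> \<otimes>\<^bsub>A\<^esub> f = f"
proof (rule eqI)
  fix z assume z: "z \<in> carrier G"
  have supp: "supp (e \<one>\<^bsub>G\<^esub>) \<subseteq> {\<one>\<^bsub>G\<^esub>}"
    by (auto simp: supp_iff split: if_splits)
  have "(\<one>\<^bsub>A\<^esub> \<otimes>\<^bsub>A\<^esub> f) z = (\<Oplus>\<^bsub>k\<^esub>x\<in>{\<one>\<^bsub>G\<^esub>}. summand (e \<one>\<^bsub>G\<^esub>) f z x)"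
    unfolding one_eq_basis by (rule mult_value[OF basis_carrier f _ supp _ z]) auto
  also have "\<dots> = f z"
    using z value_closed[OF f z] by (simp add: summand_def)
  finally show "(\<one>\<^bsub>A\<^esub> \<otimes>\<^bsub>A\<^esub> f) z = f z" .
qed (use f mult_carrier in \<open>auto simp: one_eq_basis\<close>)

text \<open>Only \<open>x = z\<close> contributes to the coefficient at \<open>z\<close>. It is added to the index set by hand,
  since \<open>f\<close> may vanish there.\<close>

lemma mult_one:
  assumes f: "f \<in> carrier A"
  shows "f \<otimes>\<^bsub>A\<^esub> \<one>\<^bsub>A\<^esub> = f"
proof (rule eqI)
  fix z assume z: "z \<in> carrier G"
  let ?h = "summand f (e \<one>\<^bsub>G\<^esub>) z"
  have S: "finite (insert z (supp f))" "insert z (supp f) \<subseteq> carrier G"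
    using z finite_supp[OF f] supp_carrier by auto
  have zero: "?h x = \<zero>\<^bsub>k\<^esub>" if x: "x \<in> carrier G" "x \<noteq> z" for x
  proof -
    have "inv\<^bsub>G\<^esub> x \<otimes>\<^bsub>G\<^esub> z \<noteq> \<one>\<^bsub>G\<^esub>"
      using mult_left_inverse[OF x(1) z] x by auto
    then show ?thesis
      using x(1) z value_closed[OF f x(1)] by (simp add: summand_def)
  qed
  have "(f \<otimes>\<^bsub>A\<^esub> \<one>\<^bsub>A\<^esub>) z = (\<Oplus>\<^bsub>k\<^esub>x\<in>insert z (supp f). ?h x)"
    unfolding one_eq_basis by (rule mult_value[OF f basis_carrier S(1) _ S(2) z]) auto
  also have "\<dots> = (\<Oplus>\<^bsub>k\<^esub>x\<in>{z}. ?h x)"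
  proof (rule K.add.finprod_mono_neutral_cong_right[OF S(1)])
    show "?h x = \<zero>\<^bsub>k\<^esub>" if "x \<in> insert z (supp f) - {z}" for x
      using that S(2) zero by blast
    show "?h \<in> insert z (supp f) \<rightarrow> carrier k"
      by (rule summand_funcset[OF f basis_carrier S(2) z])
  qed auto
  also have "\<dots> = f z"
    using z value_closed[OF f z] by (simp add: summand_def)
  finally show "(f \<otimes>\<^bsub>A\<^esub> \<one>\<^bsub>A\<^esub>) z = f z" .
qed (use f mult_carrier in \<open>auto simp: one_eq_basis\<close>)

section \<open>Homogeneous elements\<close>

lemma smult_basis_mult:
  assumes "x \<in> carrier G" "y \<in> carrier G" "s \<in> carrier k" "t \<in> carrier k"
  shows "(s \<odot>\<^bsub>A\<^esub> e x) \<otimes>\<^bsub>A\<^esub> (t \<odot>\<^bsub>A\<^esub> e y) = (s \<otimes>\<^bsub>k\<^esub> t \<otimes>\<^bsub>k\<^esub> F x y) \<odot>\<^bsub>A\<^esub> e (x \<otimes>\<^bsub>G\<^esub> y)"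
proof -
  have "(s \<odot>\<^bsub>A\<^esub> e x) \<otimes>\<^bsub>A\<^esub> (t \<odot>\<^bsub>A\<^esub> e y) = s \<odot>\<^bsub>A\<^esub> (t \<odot>\<^bsub>A\<^esub> (e x \<otimes>\<^bsub>A\<^esub> e y))"
    by (simp only: mult_smult_left[OF assms(3) basis_carrier A.smult_closed[OF assms(4) basis_carrier]]
        mult_smult_right[OF assms(4) basis_carrier basis_carrier])
  also have "e x \<otimes>\<^bsub>A\<^esub> e y = F x y \<odot>\<^bsub>A\<^esub> e (x \<otimes>\<^bsub>G\<^esub> y)"
    using twisted_group_algebra_basis_mult[OF G.group_axioms K.field_axioms cochain assms(1,2)] .
  also have "s \<odot>\<^bsub>A\<^esub> (t \<odot>\<^bsub>A\<^esub> \<dots>) = (s \<otimes>\<^bsub>k\<^esub> t \<otimes>\<^bsub>k\<^esub> F x y) \<odot>\<^bsub>A\<^esub> e (x \<otimes>\<^bsub>G\<^esub> y)"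
    using assms by (simp add: A.smult_assoc1)
  finally show ?thesis .
qed

lemma component_mult:
  assumes "x \<in> carrier G" "y \<in> carrier G" "a \<in> V x" "b \<in> V y"
  shows "a \<otimes>\<^bsub>A\<^esub> b \<in> V (x \<otimes>\<^bsub>G\<^esub> y)"
  using assms by (auto simp: component_iff smult_basis_mult)

text \<open>Both bracketings are multiples of the basis vector \<open>xyz\<close>, with coefficients
  \<open>r s t F(x,y) F(xy,z)\<close> and \<open>r s t F(y,z) F(x,yz)\<close>.\<close>

lemma component_quasi_assoc:
  assumes G: "x \<in> carrier G" "y \<in> carrier G" "z \<in> carrier G"
    and V: "a \<in> V x" "b \<in> V y" "c \<in> V z"
  shows "(a \<otimes>\<^bsub>A\<^esub> b) \<otimes>\<^bsub>A\<^esub> c = coboundary k G F x y z \<odot>\<^bsub>A\<^esub> (a \<otimes>\<^bsub>A\<^esub> (b \<otimes>\<^bsub>A\<^esub> c))"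
proof -
  let ?p = "coboundary k G F x y z"
  have p: "?p \<in> carrier k"
    using coboundary_unit[OF G] by blast
  from V obtain r s t where rst: "r \<in> carrier k" "s \<in> carrier k" "t \<in> carrier k"
    and abc: "a = r \<odot>\<^bsub>A\<^esub> e x" "b = s \<odot>\<^bsub>A\<^esub> e y" "c = t \<odot>\<^bsub>A\<^esub> e z"
    by (auto simp: component_iff)
  have "(a \<otimes>\<^bsub>A\<^esub> b) \<otimes>\<^bsub>A\<^esub> c =
      (r \<otimes>\<^bsub>k\<^esub> s \<otimes>\<^bsub>k\<^esub> t \<otimes>\<^bsub>k\<^esub> (F x y \<otimes>\<^bsub>k\<^esub> F (x \<otimes>\<^bsub>G\<^esub> y) z)) \<odot>\<^bsub>A\<^esub> e (x \<otimes>\<^bsub>G\<^esub> y \<otimes>\<^bsub>G\<^esub> z)"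
    using G rst by (simp add: abc smult_basis_mult K.m_ac)
  also have "\<dots> = (?p \<otimes>\<^bsub>k\<^esub> (r \<otimes>\<^bsub>k\<^esub> (s \<otimes>\<^bsub>k\<^esub> t \<otimes>\<^bsub>k\<^esub> F y z) \<otimes>\<^bsub>k\<^esub> F x (y \<otimes>\<^bsub>G\<^esub> z)))
      \<odot>\<^bsub>A\<^esub> e (x \<otimes>\<^bsub>G\<^esub> (y \<otimes>\<^bsub>G\<^esub> z))"
    unfolding coboundary_mult[OF G, symmetric] using G rst p by (simp add: K.m_ac G.m_assoc)
  also have "\<dots> = ?p \<odot>\<^bsub>A\<^esub> (a \<otimes>\<^bsub>A\<^esub> (b \<otimes>\<^bsub>A\<^esub> c))"
    using G rst p by (simp add: abc smult_basis_mult A.smult_assoc1[OF p])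
  finally show ?thesis .
qed

lemma graded_quasialgebra: "graded_quasialgebra G k A V (coboundary k G F)"
proof (intro graded_quasialgebra.intro graded_quasialgebra_axioms.intro
    G.group_axioms K.field_axioms A.module_axioms)
  show "\<one>\<^bsub>A\<^esub> \<in> V \<one>\<^bsub>G\<^esub>"
    using smult_basis_component[OF K.one_closed] by (simp add: one_eq_basis)
qed (rule coboundary_three_cocycle component_submodule unique_decomposition mult_carrier
    mult_add_left mult_add_right mult_smult_left mult_smult_right component_mult one_mult mult_one
    component_quasi_assoc; assumption)+

end

theorem corollary2p4:
  fixes k :: "('k, 'n) ring_scheme"
    and G :: "('g, 'm) monoid_scheme"
    and F :: "'g \<Rightarrow> 'g \<Rightarrow> 'k"
  assumes "field k"
    and "group G"
    and "two_cochain k G F"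
  shows "coboundary_graded_quasialgebra G k
           (twisted_group_algebra k G F)
           (twisted_group_algebra_component k G F)
           (\<lambda>x y z. (F x y \<otimes>\<^bsub>k\<^esub> F (x \<otimes>\<^bsub>G\<^esub> y) z) \<otimes>\<^bsub>k\<^esub>
                    inv\<^bsub>k\<^esub> (F y z \<otimes>\<^bsub>k\<^esub> F x (y \<otimes>\<^bsub>G\<^esub> z)))"
proof -
  interpret twisted_group_ring G k F
    using assms by (simp add: twisted_group_ring_def twisted_group_ring_axioms_def)
  have "coboundary_graded_quasialgebra G k A V (coboundary k G F)"
    unfolding coboundary_graded_quasialgebra_def using graded_quasialgebra cochain by blast
  then show ?thesis
    by (simp add: coboundary_def[abs_def])
qed

end
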